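(* Let $K$ be a countable finite-dimensional simplicial complex with vertex set $V$. Then $|K|$ and $\|K\|$, each with the metric induced by the $l_\infty$ metric on $\mathbb{R}[V]$, are uniformly homeomorphic via both of the bijections $\alpha\colon|K|\to\|K\|$ and $\rho\colon|K|\to\|K\|$.
   Context: Let $K$ be an abstract simplicial complex (with finite simplices) and $V$ its vertex set. $\mathbb{R}[V]$ is the vector space of all finite formal $\mathbb{R}$-linear combinations of vertices, with the $l_\infty$ metric $d(\sum x_vv,\sum y_vv)=\max_v|x_v-y_v|$. $\|K\|\subset\mathbb{R}[V]$ is the union of the convex hulls of the vertex sets of all simplices of $K$ (with this metric it is Isbell's uniform complex). $|K|\subset\mathbb{R}[V]$ is the union of the convex hulls of $\{v_1,\ v_1+v_2,\ \dots,\ v_1+\dots+v_n\}$ over all ordered collections $(v_1,\dots,v_n)$ of pairwise distinct vertices of a simplex of $K$, for all simplices of $K$. The radial bijection $\rho\colon|K|\to\|K\|$ sends each $x=\sum x_vv$ to $x/\sum_v x_v$. The radial-affine bijection $\alpha\colon|K|\to\|K\|$ sends each point $v_1+\dots+v_i$ (where $v_1,\dots,v_i$ are distinct vertices of a simplex of $K$) to $\frac1i(v_1+\dots+v_i)$ and is affine on the convex hull of $\{v_1,v_1+v_2,\dots,v_1+\dots+v_n\}$ for every ordered collection $(v_1,\dots,v_n)$ of pairwise distinct vertices of a simplex of $K$. *)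

theory Defs
  imports "HOL-Analysis.Analysis" "HOL-Analysis.Finite_Function_Topology"
begin

section \<open>Abstract simplicial complexes\<close>

definition abstract_simplicial_complex :: "'v set set \<Rightarrow> bool" where
  "abstract_simplicial_complex K \<longleftrightarrow>
     (\<forall>\<sigma>\<in>K. finite \<sigma> \<and> \<sigma> \<noteq> {}) \<and>
     (\<forall>\<sigma>\<in>K. \<forall>\<tau>. \<tau> \<noteq> {} \<and> \<tau> \<subseteq> \<sigma> \<longrightarrow> \<tau> \<in> K)"

definition vertex_set :: "'v set set \<Rightarrow> 'v set" where
  "vertex_set K = \<Union>K"

definition finite_dimensional_complex :: "'v set set \<Rightarrow> bool" where
  "finite_dimensional_complex K \<longleftrightarrow> (\<exists>n. \<forall>\<sigma>\<in>K. card \<sigma> \<le> n + 1)"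


section \<open>Formal linear combinations with the sup metric\<close>

text \<open>The metric that the library puts on the type \<open>'v \<Rightarrow>\<^sub>0 real\<close> is the \<open>l\<^sub>1\<close> one, so only the vector
  space structure of that type is used; the \<open>l\<^sub>\<infinity>\<close> metric is supplied as a \<open>metric\<close> object.\<close>

definition formal_combinations :: "'v set \<Rightarrow> ('v \<Rightarrow>\<^sub>0 real) set" where
  "formal_combinations V = {x. Poly_Mapping.keys x \<subseteq> V}"

text \<open>The maximum is over all elements of the type: coordinates outside \<open>V\<close> contribute \<open>0\<close>, and the
  range is a finite nonempty set because of the finite supports.\<close>

definition linf_dist :: "('v \<Rightarrow>\<^sub>0 real) \<Rightarrow> ('v \<Rightarrow>\<^sub>0 real) \<Rightarrow> real" where
  "linf_dist x y =
     Max (range (\<lambda>v. \<bar>Poly_Mapping.lookup x v - Poly_Mapping.lookup y v\<bar>))"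

definition linf_metric :: "'v set \<Rightarrow> ('v \<Rightarrow>\<^sub>0 real) metric" where
  "linf_metric V = metric (formal_combinations V, linf_dist)"

lemma finite_range_linf:
  "finite (range (\<lambda>v. \<bar>Poly_Mapping.lookup x v - Poly_Mapping.lookup (y :: 'v \<Rightarrow>\<^sub>0 real) v\<bar>))"
proof (rule finite_subset)
  let ?f = "\<lambda>v. \<bar>Poly_Mapping.lookup x v - Poly_Mapping.lookup y v\<bar>"
  show "range ?f \<subseteq> insert 0 (?f ` (Poly_Mapping.keys x \<union> Poly_Mapping.keys y))"
    by (auto simp: in_keys_iff)
qed simp

lemma linf_dist_le_iff:
  "linf_dist x y \<le> c \<longleftrightarrow> (\<forall>v. \<bar>Poly_Mapping.lookup x v - Poly_Mapping.lookup y v\<bar> \<le> c)"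
  unfolding linf_dist_def using finite_range_linf[of x y] by (subst Max_le_iff) auto

lemma lookup_diff_le_linf_dist:
  "\<bar>Poly_Mapping.lookup x v - Poly_Mapping.lookup y v\<bar> \<le> linf_dist x y"
  using linf_dist_le_iff[of x y "linf_dist x y"] by simp

lemma Metric_space_linf: "Metric_space (formal_combinations V) linf_dist"
proof
  fix x y z :: "'a \<Rightarrow>\<^sub>0 real"
  show "0 \<le> linf_dist x y"
    using lookup_diff_le_linf_dist[of x undefined y] by linarith
  show "linf_dist x y = linf_dist y x"
    by (simp add: linf_dist_def abs_minus_commute)
  show "linf_dist x y = 0 \<longleftrightarrow> x = y"
  proof
    assume *: "linf_dist x y = 0"
    show "x = y"
    proof (rule poly_mapping_eqI)
      fix v
      show "Poly_Mapping.lookup x v = Poly_Mapping.lookup y v"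
        using lookup_diff_le_linf_dist[of x v y] * by simp
    qed
  qed (simp add: linf_dist_def)
  show "linf_dist x z \<le> linf_dist x y + linf_dist y z"
    unfolding linf_dist_le_iff
  proof
    fix v
    show "\<bar>Poly_Mapping.lookup x v - Poly_Mapping.lookup z v\<bar> \<le> linf_dist x y + linf_dist y z"
      using lookup_diff_le_linf_dist[of x v y] lookup_diff_le_linf_dist[of y v z] by linarith
  qed
qed

lemma mspace_linf_metric [simp]: "mspace (linf_metric V) = formal_combinations V"
  unfolding linf_metric_def by (rule Metric_space.mspace_metric[OF Metric_space_linf])

lemma mdist_linf_metric [simp]: "mdist (linf_metric V) = linf_dist"
  unfolding linf_metric_def by (rule Metric_space.mdist_metric[OF Metric_space_linf])


section \<open>The two realizations\<close>

abbreviation basis_vector :: "'v \<Rightarrow> ('v \<Rightarrow>\<^sub>0 real)" where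
  "basis_vector v \<equiv> Poly_Mapping.single v 1"

definition uniform_complex :: "'v set set \<Rightarrow> ('v \<Rightarrow>\<^sub>0 real) set" (\<open>\<parallel>_\<parallel>\<^sub>K\<close>) where
  "\<parallel>K\<parallel>\<^sub>K = (\<Union>\<sigma>\<in>K. convex hull (basis_vector ` \<sigma>))"

definition ordered_collections :: "'v set set \<Rightarrow> 'v list set" where
  "ordered_collections K = {vs. vs \<noteq> [] \<and> distinct vs \<and> (\<exists>\<sigma>\<in>K. set vs \<subseteq> \<sigma>)}"

definition vertex_sum :: "'v list \<Rightarrow> ('v \<Rightarrow>\<^sub>0 real)" where
  "vertex_sum vs = (\<Sum>v\<leftarrow>vs. basis_vector v)"

text \<open>For \<open>vs = [v\<^sub>1, \<dots>, v\<^sub>n]\<close> this is the convex hull of \<open>v\<^sub>1, v\<^sub>1 + v\<^sub>2, \<dots>, v\<^sub>1 + \<dots> + v\<^sub>n\<close>.\<close>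

definition flag_simplex :: "'v list \<Rightarrow> ('v \<Rightarrow>\<^sub>0 real) set" where
  "flag_simplex vs = convex hull ((\<lambda>i. vertex_sum (take i vs)) ` {1..length vs})"

definition flag_complex :: "'v set set \<Rightarrow> ('v \<Rightarrow>\<^sub>0 real) set" (\<open>\<bar>_\<bar>\<^sub>K\<close>) where
  "\<bar>K\<bar>\<^sub>K = (\<Union>vs\<in>ordered_collections K. flag_simplex vs)"

lemma keys_scaleR_subset:
  "Poly_Mapping.keys (c *\<^sub>R x) \<subseteq> Poly_Mapping.keys (x :: 'v \<Rightarrow>\<^sub>0 real)"
proof -
  have "finite {v. c *\<^sub>R Poly_Mapping.lookup x v \<noteq> 0}"
    by (rule finite_subset[OF _ finite_keys[of x]]) (auto simp: in_keys_iff)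
  then have "Poly_Mapping.lookup (c *\<^sub>R x) v = c *\<^sub>R Poly_Mapping.lookup x v" for v
    by (simp add: scaleR_poly_mapping_def Abs_poly_mapping_inverse)
  then show ?thesis
    by (auto simp: in_keys_iff)
qed

lemma convex_formal_combinations: "convex (formal_combinations V)"
proof (rule convexI)
  fix x y :: "'a \<Rightarrow>\<^sub>0 real" and a b :: real
  assume "x \<in> formal_combinations V" "y \<in> formal_combinations V"
  then have "Poly_Mapping.keys (a *\<^sub>R x) \<union> Poly_Mapping.keys (b *\<^sub>R y) \<subseteq> V"
    using keys_scaleR_subset[of a x] keys_scaleR_subset[of b y]
    unfolding formal_combinations_def by blast
  then show "a *\<^sub>R x + b *\<^sub>R y \<in> formal_combinations V"
    using keys_add[of "a *\<^sub>R x" "b *\<^sub>R y"] unfolding formal_combinations_def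
    by blast
qed

lemma uniform_complex_subset: "\<parallel>K\<parallel>\<^sub>K \<subseteq> formal_combinations (vertex_set K)"
proof -
  have "convex hull (basis_vector ` \<sigma>) \<subseteq> formal_combinations (vertex_set K)" if "\<sigma> \<in> K" for \<sigma>
    by (rule hull_minimal)
      (use that in \<open>auto simp: formal_combinations_def vertex_set_def
        convex_formal_combinations[unfolded formal_combinations_def]\<close>)
  then show ?thesis
    by (auto simp: uniform_complex_def)
qed

lemma keys_vertex_sum: "Poly_Mapping.keys (vertex_sum vs) \<subseteq> set vs"
proof (induction vs)
  case (Cons v vs)
  then show ?case
    using keys_add[of "basis_vector v" "vertex_sum vs"] by (auto simp: vertex_sum_def)
qed (simp add: vertex_sum_def)

lemma flag_complex_subset: "\<bar>K\<bar>\<^sub>K \<subseteq> formal_combinations (vertex_set K)"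
proof -
  have "flag_simplex vs \<subseteq> formal_combinations (vertex_set K)" if "vs \<in> ordered_collections K" for vs
    unfolding flag_simplex_def
  proof (rule hull_minimal)
    have "set vs \<subseteq> vertex_set K"
      using that by (auto simp: ordered_collections_def vertex_set_def)
    then have "vertex_sum (take i vs) \<in> formal_combinations (vertex_set K)" for i
      using keys_vertex_sum[of "take i vs"] set_take_subset[of i vs]
      by (auto simp: formal_combinations_def)
    then show "(\<lambda>i. vertex_sum (take i vs)) ` {1..length vs} \<subseteq> formal_combinations (vertex_set K)"
      by blast
  qed (rule convex_formal_combinations)
  then show ?thesis
    by (auto simp: flag_complex_def)
qed


section \<open>The radial and the radial-affine map\<close>

definition radial_map :: "('v \<Rightarrow>\<^sub>0 real) \<Rightarrow> ('v \<Rightarrow>\<^sub>0 real)" where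
  "radial_map x = x /\<^sub>R (\<Sum>v\<in>Poly_Mapping.keys x. Poly_Mapping.lookup x v)"

text \<open>Intended for convex \<open>S\<close> only.\<close>

definition affine_map_on :: "'a::real_vector set \<Rightarrow> ('a \<Rightarrow> 'b::real_vector) \<Rightarrow> bool" where
  "affine_map_on S f \<longleftrightarrow>
     (\<forall>x\<in>S. \<forall>y\<in>S. \<forall>t\<in>{0..1}. f ((1 - t) *\<^sub>R x + t *\<^sub>R y) = (1 - t) *\<^sub>R f x + t *\<^sub>R f y)"

definition is_radial_affine_map ::
    "'v set set \<Rightarrow> (('v \<Rightarrow>\<^sub>0 real) \<Rightarrow> ('v \<Rightarrow>\<^sub>0 real)) \<Rightarrow> bool" where
  "is_radial_affine_map K f \<longleftrightarrow>
     (\<forall>vs\<in>ordered_collections K.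
        f (vertex_sum vs) = (1 / real (length vs)) *\<^sub>R vertex_sum vs) \<and>
     (\<forall>vs\<in>ordered_collections K. affine_map_on (flag_simplex vs) f)"

text \<open>The conditions determine the map on \<open>\<bar>K\<bar>\<^sub>K\<close>; extensionality pins down its values elsewhere.\<close>

definition radial_affine_map :: "'v set set \<Rightarrow> ('v \<Rightarrow>\<^sub>0 real) \<Rightarrow> ('v \<Rightarrow>\<^sub>0 real)" where
  "radial_affine_map K = (THE f. f \<in> extensional \<bar>K\<bar>\<^sub>K \<and> is_radial_affine_map K f)"


section \<open>Uniform homeomorphisms\<close>

definition uniform_homeomorphism :: "'a metric \<Rightarrow> 'b metric \<Rightarrow> ('a \<Rightarrow> 'b) \<Rightarrow> bool" where
  "uniform_homeomorphism m1 m2 f \<longleftrightarrow>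
     bij_betw f (mspace m1) (mspace m2) \<and>
     uniformly_continuous_map m1 m2 f \<and>
     uniformly_continuous_map m2 m1 (inv_into (mspace m1) f)"

end

theory Submission
  imports Defs
begin

text \<open>
  In coordinates, \<open>\<bar>K\<bar>\<^sub>K\<close> consists of the nonnegative vectors with support in \<open>K\<close> and maximum \<open>1\<close>,
  and \<open>\<parallel>K\<parallel>\<^sub>K\<close> of those with sum \<open>1\<close>. If all simplices have at most \<open>n\<close> vertices, two points involve at
  most \<open>2n\<close> coordinates, and both bijections are bi-Lipschitz with constants depending only on \<open>n\<close>.
  For \<open>\<rho>\<close> this holds because the sum of the coordinates is Lipschitz and lies in \<open>[1, n]\<close> on \<open>\<bar>K\<bar>\<^sub>K\<close>.
  The inverse of \<open>\<alpha>\<close> is \<open>\<beta>(y)\<^sub>v = \<Sum>\<^sub>w min y\<^sub>w y\<^sub>v\<close>: it is affine on every set of points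
  whose coordinates are ordered in the same way, and it is clearly Lipschitz. Conversely,
  \<open>e\<^sub>v = \<bar>y\<^sub>v - z\<^sub>v\<bar>\<close> is at most the distance of \<open>\<beta>(y)\<close> and \<open>\<beta>(z)\<close> plus the sum of the \<open>e\<^sub>w\<close> over all \<open>w\<close>
  with \<open>min y\<^sub>w z\<^sub>w < min y\<^sub>v z\<^sub>v\<close>, and this recursion has depth at most \<open>2n\<close>.
\<close>

section \<open>Coordinates, supports and coordinate sums of formal combinations\<close>

abbreviation coord :: "('v \<Rightarrow>\<^sub>0 real) \<Rightarrow> 'v \<Rightarrow> real" where
  "coord \<equiv> Poly_Mapping.lookup"

abbreviation support :: "('v \<Rightarrow>\<^sub>0 real) \<Rightarrow> 'v set" where
  "support \<equiv> Poly_Mapping.keys"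

lemma lookup_scaleR [simp]: "coord (c *\<^sub>R x) v = c * coord x v"
proof -
  have "finite {v. c * coord x v \<noteq> 0}"
    by (rule finite_subset[OF _ finite_keys[of x]]) (auto simp: in_keys_iff)
  then show ?thesis
    by (simp add: scaleR_poly_mapping_def Abs_poly_mapping_inverse)
qed

lemma lookup_vertex_sum:
  "distinct vs \<Longrightarrow> coord (vertex_sum vs) v = (if v \<in> set vs then 1 else 0)"
  by (induction vs) (auto simp: vertex_sum_def lookup_add lookup_single when_def)

definition coord_sum :: "('v \<Rightarrow>\<^sub>0 real) \<Rightarrow> real" where
  "coord_sum x = (\<Sum>v\<in>support x. coord x v)"

text \<open>Lets the sums of two vectors with different supports be compared over one common finite
  index set.\<close>

lemma coord_sum_superset:
  assumes "finite W" "support x \<subseteq> W"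
  shows "coord_sum x = (\<Sum>v\<in>W. coord x v)"
  unfolding coord_sum_def by (rule sum.mono_neutral_left) (use assms in \<open>auto simp: in_keys_iff\<close>)

lemma coord_sum_add: "coord_sum (x + y) = coord_sum x + coord_sum y"
  using coord_sum_superset[of "support x \<union> support y" x] coord_sum_superset[of "support x \<union> support y" y]
    coord_sum_superset[of "support x \<union> support y" "x + y"] keys_add[of x y]
  by (simp add: lookup_add sum.distrib)

lemma coord_sum_scaleR: "coord_sum (c *\<^sub>R x) = c * coord_sum x"
  using coord_sum_superset[OF finite_keys keys_scaleR_subset[of c x]]
  by (simp add: coord_sum_def sum_distrib_left)

lemma coord_sum_vertex_sum: "distinct vs \<Longrightarrow> coord_sum (vertex_sum vs) = real (length vs)"
  using coord_sum_superset[OF _ keys_vertex_sum[of vs]]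
  by (simp add: lookup_vertex_sum distinct_card)

lemma support_scaleR: "c \<noteq> 0 \<Longrightarrow> support (c *\<^sub>R x) = support x"
  by (auto simp: in_keys_iff)

lemma support_subset_affine:
  assumes "support x \<subseteq> S" "support y \<subseteq> S"
  shows "support (a *\<^sub>R x + b *\<^sub>R y) \<subseteq> S"
  using assms keys_add[of "a *\<^sub>R x" "b *\<^sub>R y"] keys_scaleR_subset[of a x] keys_scaleR_subset[of b y]
  by blast

lemma obtain_max_coord:
  assumes nonneg: "\<And>v. 0 \<le> coord y v" and "support y \<noteq> {}"
  obtains u where "0 < coord y u" "\<And>v. coord y v \<le> coord y u"
proof -
  let ?M = "Max (coord y ` support y)"
  have "?M \<in> coord y ` support y"
    using assms(2) by (intro Max_in) auto
  then obtain u where u: "u \<in> support y" "coord y u = ?M"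
    by auto
  have pos: "0 < coord y u"
    using u(1) nonneg[of u] by (simp add: in_keys_iff order_less_le)
  have "coord y v \<le> coord y u" for v
  proof (cases "v \<in> support y")
    case True
    then show ?thesis
      unfolding u(2) by (intro Max_ge) auto
  next
    case False
    then show ?thesis
      using pos by (simp add: in_keys_iff)
  qed
  with pos show thesis
    by (rule that)
qed

lemma linf_dist_nonneg: "0 \<le> linf_dist x y"
  using lookup_diff_le_linf_dist[of x undefined y] by linarith

lemma card_support_union_le:
  assumes "card (support x) \<le> n" "card (support y) \<le> n"
  shows "card (support x \<union> support y) \<le> 2 * n"
  using assms card_Un_le[of "support x" "support y"] by linarith

text \<open>Only coordinates in the union of the two supports contribute. There are at most
  \<open>2 * n\<close> of them, so the constant depends on the dimension only.\<close>

lemma coord_sum_Lipschitz: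
  assumes "card (support x) \<le> n" "card (support y) \<le> n"
  shows "\<bar>coord_sum x - coord_sum y\<bar> \<le> real (2 * n) * linf_dist x y"
proof -
  let ?W = "support x \<union> support y"
  have "\<bar>coord_sum x - coord_sum y\<bar> = \<bar>\<Sum>v\<in>?W. coord x v - coord y v\<bar>"
    by (simp add: coord_sum_superset[of ?W] sum_subtractf)
  also have "\<dots> \<le> (\<Sum>v\<in>?W. linf_dist x y)"
    by (intro order_trans[OF sum_abs] sum_mono lookup_diff_le_linf_dist)
  also have "\<dots> = real (card ?W) * linf_dist x y"
    by simp
  also have "\<dots> \<le> real (2 * n) * linf_dist x y"
    using card_support_union_le[OF assms]
    by (intro mult_right_mono linf_dist_nonneg) linarith
  finally show ?thesis .
qed

section \<open>The two realizations in coordinates\<close>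

text \<open>Forward, the conditions with support inside a fixed simplex cut out a convex set
  containing its vertices. Backward, the coordinates of a point are themselves the coefficients of a
  convex combination.\<close>

lemma uniform_complex_eq:
  assumes K: "abstract_simplicial_complex K"
  shows "\<parallel>K\<parallel>\<^sub>K = {y. support y \<in> K \<and> (\<forall>v. 0 \<le> coord y v) \<and> coord_sum y = 1}"
proof (intro set_eqI iffI; clarify?)
  fix y assume "y \<in> \<parallel>K\<parallel>\<^sub>K"
  then obtain \<sigma> where \<sigma>: "\<sigma> \<in> K" and y: "y \<in> convex hull (basis_vector ` \<sigma>)"
    by (auto simp: uniform_complex_def)
  let ?P = "{y. support y \<subseteq> \<sigma> \<and> (\<forall>v. 0 \<le> coord y v) \<and> coord_sum y = 1}"
  have "convex ?P"
  proof (rule convexI)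
    fix x y and a b :: real
    assume "x \<in> ?P" "y \<in> ?P" "0 \<le> a" "0 \<le> b" "a + b = 1"
    then show "a *\<^sub>R x + b *\<^sub>R y \<in> ?P"
      using support_subset_affine[of x \<sigma> y a b]
      by (simp add: lookup_add coord_sum_add coord_sum_scaleR)
  qed
  moreover have "basis_vector ` \<sigma> \<subseteq> ?P"
    by (auto simp: lookup_single when_def coord_sum_def)
  ultimately have *: "y \<in> ?P"
    by (rule subsetD[OF hull_minimal y, rotated])
  then have "support y \<noteq> {}"
    by (auto simp: coord_sum_def)
  then show "support y \<in> K \<and> (\<forall>v. 0 \<le> coord y v) \<and> coord_sum y = 1"
    using K \<sigma> * unfolding abstract_simplicial_complex_def by blast
next
  fix y assume y: "support y \<in> K" "\<forall>v. 0 \<le> coord y v" "coord_sum y = 1"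
  have "(\<Sum>v\<in>support y. coord y v *\<^sub>R basis_vector v) \<in> convex hull (basis_vector ` support y)"
    by (rule convex_sum) (use y in \<open>auto simp: coord_sum_def hull_inc\<close>)
  also have "(\<Sum>v\<in>support y. coord y v *\<^sub>R basis_vector v) = y"
    by (rule poly_mapping_eqI) (auto simp: lookup_sum lookup_single when_def sum.delta' if_distrib
        in_keys_iff cong: if_cong)
  finally show "y \<in> \<parallel>K\<parallel>\<^sub>K"
    using y by (auto simp: uniform_complex_def)
qed

text \<open>For distinct \<open>vs\<close>, this is the convex cone generated by the initial sums
  \<open>vertex_sum (take i vs)\<close>. Both simplices attached to \<open>vs\<close> are slices of
  it: \<open>flag_simplex vs\<close> at head coordinate 1, and \<open>cell vs\<close> at coordinate
  sum 1.\<close>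

definition chamber :: "'v list \<Rightarrow> ('v \<Rightarrow>\<^sub>0 real) set" where
  "chamber vs = {x. support x \<subseteq> set vs \<and> (\<forall>v. 0 \<le> coord x v) \<and>
     sorted_wrt (\<lambda>v w. coord x w \<le> coord x v) vs}"

lemma chamber_outside: "x \<in> chamber vs \<Longrightarrow> v \<notin> set vs \<Longrightarrow> coord x v = 0"
  by (auto simp: chamber_def subset_iff in_keys_iff)

lemma chamber_scaleR: "x \<in> chamber vs \<Longrightarrow> 0 \<le> c \<Longrightarrow> c *\<^sub>R x \<in> chamber vs"
  using keys_scaleR_subset[of c x]
  by (auto simp: chamber_def sorted_wrt_iff_nth_less mult_left_mono)

lemma chamber_affine:
  assumes "x \<in> chamber vs" "y \<in> chamber vs" "0 \<le> a" "0 \<le> b"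
  shows "a *\<^sub>R x + b *\<^sub>R y \<in> chamber vs"
  using assms support_subset_affine[of x "set vs" y a b]
  by (auto simp: chamber_def sorted_wrt_iff_nth_less lookup_add intro!: add_mono mult_left_mono)

text \<open>Positions in \<open>vs\<close> decide the order of two listed vertices for both vectors
  at once. An unlisted vertex has coordinate 0 in both, which is minimal. This is what makes
  \<open>min\<close> additive on a chamber.\<close>

lemma chamber_comonotone:
  assumes "x \<in> chamber vs" "y \<in> chamber vs"
  shows "(coord x v \<le> coord x w \<and> coord y v \<le> coord y w) \<or>
    (coord x w \<le> coord x v \<and> coord y w \<le> coord y v)"
proof (cases "v \<in> set vs \<and> w \<in> set vs")
  case True
  then obtain i j where "i < length vs" "j < length vs" "v = vs ! i" "w = vs ! j"
    by (metis in_set_conv_nth)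
  moreover have "coord x (vs ! l) \<le> coord x (vs ! k) \<and> coord y (vs ! l) \<le> coord y (vs ! k)"
    if "k < l" "l < length vs" for k l
    using assms that unfolding chamber_def sorted_wrt_iff_nth_less by blast
  ultimately show ?thesis
    by (metis linorder_neqE_nat order_refl)
next
  case False
  have nonneg: "0 \<le> coord x u" "0 \<le> coord y u" for u
    using assms by (simp_all add: chamber_def)
  from False consider "v \<notin> set vs" | "w \<notin> set vs"
    by blast
  then show ?thesis
    by cases (use assms nonneg in \<open>simp_all add: chamber_outside\<close>)
qed

lemma vertex_sum_take_in_chamber:
  assumes "distinct vs"
  shows "vertex_sum (take i vs) \<in> chamber vs"
proof -
  have "vs ! j \<in> set (take i vs) \<longleftrightarrow> j < i" if "j < length vs" for j
    using that assms by (auto simp: in_set_conv_nth nth_eq_iff_index_eq)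
  then show ?thesis
    using assms keys_vertex_sum[of "take i vs"] set_take_subset[of i vs]
    by (auto simp: chamber_def lookup_vertex_sum sorted_wrt_iff_nth_less)
qed

text \<open>Abel summation along the list: the coefficients are the successive drops of the
  coordinates, which are nonnegative because the coordinates decrease.\<close>

lemma chamber_decomposition:
  assumes "distinct vs" "x \<in> chamber vs"
  shows "\<exists>t. (\<forall>i. 0 \<le> t i) \<and> x = (\<Sum>i\<in>{1..length vs}. t i *\<^sub>R vertex_sum (take i vs))"
  using assms
proof (induction vs arbitrary: x rule: rev_induct)
  case Nil
  then have "x = 0"
    by (auto simp: chamber_def)
  then show ?case
    by auto
next
  case (snoc v vs)
  \<comment> \<open>The last vertex carries the smallest coordinate. Subtracting it from all listed
    coordinates removes \<open>v\<close> from the support and keeps the others nonnegative and in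
    order.\<close>
  let ?z = "x - coord x v *\<^sub>R vertex_sum (vs @ [v])"
  have lookup_z: "coord ?z u = coord x u - (if u \<in> set vs \<or> u = v then coord x v else 0)" for u
    using snoc.prems by (simp add: lookup_minus lookup_vertex_sum)
  have x0: "coord x u = 0" if "u \<notin> set vs" "u \<noteq> v" for u
    using that chamber_outside[OF snoc.prems(2)] by simp
  have le: "coord x v \<le> coord x u" if "u \<in> set vs" for u
    using that snoc.prems by (auto simp: chamber_def sorted_wrt_append)
  have "?z \<in> chamber vs"
    unfolding chamber_def
  proof (intro CollectI conjI allI subsetI)
    fix u
    show "0 \<le> coord ?z u"
      using x0[of u] le[of u] by (auto simp: lookup_z)
    assume "u \<in> support ?z"
    then show "u \<in> set vs"
      using x0[of u] by (auto simp: in_keys_iff lookup_z split: if_splits)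
  next
    show "sorted_wrt (\<lambda>v w. coord ?z w \<le> coord ?z v) vs"
      using snoc.prems
      by (auto simp: lookup_z chamber_def sorted_wrt_append elim!: sorted_wrt_mono_rel[rotated])
  qed
  then obtain t where t: "\<forall>i. 0 \<le> t i" "?z = (\<Sum>i\<in>{1..length vs}. t i *\<^sub>R vertex_sum (take i vs))"
    using snoc.IH[of ?z] snoc.prems by auto
  let ?t = "t(Suc (length vs) := coord x v)"
  have "x = ?z + coord x v *\<^sub>R vertex_sum (vs @ [v])"
    by simp
  also have "\<dots> = (\<Sum>i\<in>{1..length (vs @ [v])}. ?t i *\<^sub>R vertex_sum (take i (vs @ [v])))"
    unfolding t(2) by simp
  finally show ?case
    using t(1) snoc.prems by (intro exI[of _ ?t]) (auto simp: chamber_def)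
qed

text \<open>Every generator has coordinate 1 at the head of \<open>vs\<close>, so the head
  coordinate is the sum of the coefficients. When it equals 1, the conic decomposition is a convex
  one.\<close>

lemma flag_simplex_eq:
  assumes "distinct vs" "vs \<noteq> []"
  shows "flag_simplex vs = {x \<in> chamber vs. coord x (hd vs) = 1}"
proof (intro equalityI subsetI)
  have hd: "coord (vertex_sum (take i vs)) (hd vs) = 1" if "i \<in> {1..length vs}" for i
    using that assms hd_in_set[of "take i vs"] by (simp add: lookup_vertex_sum hd_take)
  have "convex {x \<in> chamber vs. coord x (hd vs) = 1}"
    by (rule convexI) (simp add: chamber_affine lookup_add)
  then have "flag_simplex vs \<subseteq> {x \<in> chamber vs. coord x (hd vs) = 1}"
    unfolding flag_simplex_def
    by (intro hull_minimal) (use assms hd in \<open>auto simp: vertex_sum_take_in_chamber\<close>)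
  then show "x \<in> {x \<in> chamber vs. coord x (hd vs) = 1}" if "x \<in> flag_simplex vs" for x
    using that by blast
  fix x assume "x \<in> {x \<in> chamber vs. coord x (hd vs) = 1}"
  then have x: "x \<in> chamber vs" "coord x (hd vs) = 1"
    by auto
  from chamber_decomposition[OF assms(1) x(1)] obtain t
    where t: "\<forall>i. 0 \<le> t i" "x = (\<Sum>i\<in>{1..length vs}. t i *\<^sub>R vertex_sum (take i vs))"
    by blast
  have "coord x (hd vs) = sum t {1..length vs}"
    unfolding t(2) by (simp add: lookup_sum hd)
  then have "sum t {1..length vs} = 1"
    using x(2) by simp
  then show "x \<in> flag_simplex vs"
    unfolding t(2) flag_simplex_def using t(1)
    by (intro convex_sum) (auto intro: hull_inc)
qed

lemma obtain_chamber:
  assumes "\<And>v. 0 \<le> coord x v"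
  obtains vs where "distinct vs" "set vs = support x" "x \<in> chamber vs"
proof -
  obtain us where us: "set us = support x" "distinct us"
    using finite_distinct_list[of "support x"] by auto
  \<comment> \<open>\<open>sort_key\<close> sorts in ascending order, hence the negated key.\<close>
  let ?vs = "sort_key (\<lambda>v. - coord x v) us"
  have "sorted_wrt (\<lambda>v w. coord x w \<le> coord x v) ?vs"
    using sorted_sort_key[of "\<lambda>v. - coord x v" us] by (simp add: sorted_map)
  then show thesis
    using that[of ?vs] us assms by (simp add: chamber_def)
qed

text \<open>Sorting the support by decreasing coordinate puts a vertex with the maximal coordinate 1
  at the head, which selects a flag simplex containing the point.\<close>

lemma flag_complex_eq:
  assumes K: "abstract_simplicial_complex K"
  shows "\<bar>K\<bar>\<^sub>K = {x. support x \<in> K \<and> (\<forall>v. 0 \<le> coord x v \<and> coord x v \<le> 1) \<and> (\<exists>v. coord x v = 1)}"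
proof (intro set_eqI iffI; clarify?)
  fix x assume "x \<in> \<bar>K\<bar>\<^sub>K"
  then obtain vs \<sigma> where vs: "distinct vs" "vs \<noteq> []" and \<sigma>: "\<sigma> \<in> K" "set vs \<subseteq> \<sigma>"
    and x: "x \<in> flag_simplex vs"
    by (auto simp: flag_complex_def ordered_collections_def)
  then have x: "x \<in> chamber vs" "coord x (hd vs) = 1"
    using flag_simplex_eq[OF vs] by auto
  then have "support x \<noteq> {}" "support x \<subseteq> \<sigma>"
    using \<sigma> by (auto simp: chamber_def)
  then have "support x \<in> K"
    using K \<sigma> unfolding abstract_simplicial_complex_def by blast
  moreover have "coord x v \<le> 1" for v
  proof (cases "v \<in> set vs")
    case True
    then show ?thesis
      using x vs by (cases vs) (auto simp: chamber_def)
  next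
    case False
    then have "coord x v = 0"
      by (rule chamber_outside[OF x(1)])
    then show ?thesis
      by simp
  qed
  ultimately show "support x \<in> K \<and> (\<forall>v. 0 \<le> coord x v \<and> coord x v \<le> 1) \<and> (\<exists>v. coord x v = 1)"
    using x by (auto simp: chamber_def)
next
  fix x u assume x: "support x \<in> K" "\<forall>v. 0 \<le> coord x v \<and> coord x v \<le> 1" "coord x u = 1"
  then obtain vs where vs: "distinct vs" "set vs = support x" "x \<in> chamber vs"
    using obtain_chamber[of x] by blast
  have u: "u \<in> set vs"
    using x(3) vs(2) by (simp add: in_keys_iff)
  then have "vs \<noteq> []" "coord x u \<le> coord x (hd vs)"
    using vs(3) by (cases vs; auto simp: chamber_def)+
  then have "coord x (hd vs) = 1"
    using x by (simp add: antisym)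
  then have "x \<in> flag_simplex vs"
    using flag_simplex_eq vs \<open>vs \<noteq> []\<close> by blast
  then show "x \<in> \<bar>K\<bar>\<^sub>K"
    using vs x \<open>vs \<noteq> []\<close> by (auto simp: flag_complex_def ordered_collections_def)
qed

section \<open>The inverse of the radial-affine map\<close>

text \<open>If \<open>y\<close> has coordinates \<open>y\<^sub>1 \<ge> \<dots> \<ge> y\<^sub>n\<close>, then \<open>y = \<Sum> t\<^sub>i (v\<^sub>1 + \<dots> + v\<^sub>i) / i\<close> with
  \<open>t\<^sub>i = i (y\<^sub>i - y\<^bsub>i+1\<^esub>)\<close>, so \<open>\<alpha>\<^sup>-\<^sup>1 y = \<Sum> t\<^sub>i (v\<^sub>1 + \<dots> + v\<^sub>i)\<close> has \<open>k\<close>-th coordinate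
  \<open>k y\<^sub>k + y\<^bsub>k+1\<^esub> + \<dots> + y\<^sub>n\<close>. The following formula expresses this without the ordering.\<close>

definition min_sum_map :: "('v \<Rightarrow>\<^sub>0 real) \<Rightarrow> ('v \<Rightarrow>\<^sub>0 real)" where
  "min_sum_map y =
     (\<Sum>v\<in>support y. Poly_Mapping.single v (\<Sum>w\<in>support y. min (coord y w) (coord y v)))"

text \<open>Indices outside the support contribute \<open>min 0 (coord y v)\<close>, which vanishes
  by nonnegativity. Hence any finite superset may serve as index set.\<close>

lemma lookup_min_sum_map:
  assumes nonneg: "\<And>v. 0 \<le> coord y v" and W: "finite W" "support y \<subseteq> W"
  shows "coord (min_sum_map y) v = (\<Sum>w\<in>W. min (coord y w) (coord y v))"
proof -
  have "coord (min_sum_map y) v = (\<Sum>w\<in>support y. min (coord y w) (coord y v))"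
  proof (cases "v \<in> support y")
    case True
    then show ?thesis
      by (simp add: min_sum_map_def lookup_sum lookup_single when_def)
  next
    case False
    then have "coord (min_sum_map y) v = 0"
      unfolding min_sum_map_def lookup_sum by (intro sum.neutral) (auto simp: lookup_single when_def)
    with False show ?thesis
      using nonneg by (simp add: in_keys_iff)
  qed
  also have "\<dots> = (\<Sum>w\<in>W. min (coord y w) (coord y v))"
    by (rule sum.mono_neutral_left) (use assms in \<open>auto simp: in_keys_iff\<close>)
  finally show ?thesis .
qed

section \<open>Lipschitz bounds for \<open>min_sum_map\<close> and its inverse\<close>

lemma min_sum_map_Lipschitz:
  assumes nonneg: "\<And>v. 0 \<le> coord y v" "\<And>v. 0 \<le> coord z v"
    and card: "card (support y) \<le> n" "card (support z) \<le> n"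
  shows "linf_dist (min_sum_map y) (min_sum_map z) \<le> real (2 * n) * linf_dist y z"
  unfolding linf_dist_le_iff
proof
  fix v
  let ?W = "support y \<union> support z"
  have "\<bar>coord (min_sum_map y) v - coord (min_sum_map z) v\<bar> =
      \<bar>\<Sum>w\<in>?W. min (coord y w) (coord y v) - min (coord z w) (coord z v)\<bar>"
    using nonneg by (simp add: lookup_min_sum_map[of _ ?W] sum_subtractf)
  also have "\<dots> \<le> (\<Sum>w\<in>?W. linf_dist y z)"
  proof (intro order_trans[OF sum_abs] sum_mono)
    fix w
    show "\<bar>min (coord y w) (coord y v) - min (coord z w) (coord z v)\<bar> \<le> linf_dist y z"
      using lookup_diff_le_linf_dist[of y w z] lookup_diff_le_linf_dist[of y v z] by linarith
  qed
  also have "\<dots> = real (card ?W) * linf_dist y z"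
    by simp
  also have "\<dots> \<le> real (2 * n) * linf_dist y z"
    using card_support_union_le[OF card]
    by (intro mult_right_mono linf_dist_nonneg) linarith
  finally show "\<bar>coord (min_sum_map y) v - coord (min_sum_map z) v\<bar> \<le> real (2 * n) * linf_dist y z" .
qed

text \<open>Compare \<open>\<Sum>\<^sub>w min y\<^sub>w y\<^sub>v\<close> with \<open>\<Sum>\<^sub>w min z\<^sub>w z\<^sub>v\<close> where \<open>y\<^sub>v \<ge> z\<^sub>v\<close>: raising the level from \<open>z\<^sub>v\<close> to \<open>y\<^sub>v\<close>
  gains at least \<open>y\<^sub>v - z\<^sub>v\<close> from the term \<open>w = v\<close>, and a loss at \<open>w\<close> requires \<open>y\<^sub>w < z\<^sub>v\<close>.\<close>

lemma min_sum_map_coord_diff: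
  assumes nonneg: "\<And>v. 0 \<le> coord y v" "\<And>v. 0 \<le> coord z v"
    and W: "finite W" "support y \<union> support z \<subseteq> W"
  shows "\<bar>coord y v - coord z v\<bar> \<le> linf_dist (min_sum_map y) (min_sum_map z) +
    (\<Sum>w\<in>{w\<in>W. min (coord y w) (coord z w) < min (coord y v) (coord z v)}. \<bar>coord y w - coord z w\<bar>)"
proof -
  have *: "coord a v - coord b v \<le> linf_dist (min_sum_map a) (min_sum_map b) +
      (\<Sum>w\<in>{w\<in>W. min (coord a w) (coord b w) < min (coord a v) (coord b v)}. \<bar>coord a w - coord b w\<bar>)"
    (is "_ \<le> _ + sum ?e ?L")
    if ab: "coord b v \<le> coord a v" "\<And>v. 0 \<le> coord a v" "\<And>v. 0 \<le> coord b v"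
      "support a \<union> support b \<subseteq> W" for a b
  proof (cases "v \<in> W")
    case True
    have "coord a v - coord b v = (\<Sum>w\<in>W. if w = v then coord a v - coord b v else 0)"
      using True W by simp
    \<comment> \<open>Termwise: at \<open>w = v\<close> the difference of minima is exactly the left
      side. For other \<open>w\<close> outside \<open>?L\<close> both coordinates are at least
      \<open>coord b v\<close>, so the difference is nonnegative. For \<open>w\<close> in
      \<open>?L\<close> it is at least \<open>- ?e w\<close>.\<close>
    also have "\<dots> \<le> (\<Sum>w\<in>W. (min (coord a w) (coord a v) - min (coord b w) (coord b v)) +
        (if w \<in> ?L then ?e w else 0))"
      by (rule sum_mono) (use ab(1) in auto)
    also have "\<dots> = coord (min_sum_map a) v - coord (min_sum_map b) v + sum ?e ?L"
      using W ab by (simp add: lookup_min_sum_map[of _ W] sum.distrib sum_subtractf sum.If_cases Int_def)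
    finally show ?thesis
      using lookup_diff_le_linf_dist[of "min_sum_map a" v "min_sum_map b"] by linarith
  next
    case False
    then have "coord a v = 0" "coord b v = 0"
      using ab by (auto simp: in_keys_iff subset_iff)
    then show ?thesis
      by (simp add: linf_dist_nonneg sum_nonneg add_nonneg_nonneg)
  qed
  have sym: "linf_dist (min_sum_map z) (min_sum_map y) = linf_dist (min_sum_map y) (min_sum_map z)"
    by (simp add: linf_dist_def abs_minus_commute)
  show ?thesis
  proof (cases "coord z v \<le> coord y v")
    case True
    then show ?thesis
      \<comment> \<open>The first premise of \<open>*\<close> mentions \<open>b\<close> before
        \<open>a\<close>, so this takes \<open>a\<close> to be \<open>y\<close> and \<open>b\<close>
        to be \<open>z\<close>.\<close>
      using *[of z y] nonneg W by simp
  next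
    case False
    then show ?thesis
      using *[of y z] nonneg W by (simp add: sym min.commute abs_minus_commute)
  qed
qed

text \<open>Strong induction on the number of elements below \<open>v\<close> in the level function
  \<open>\<mu>\<close>. The recursion only refers to strictly lower levels, and each level costs a
  factor of at most \<open>1 + card W\<close>.\<close>

lemma geometric_growth_bound:
  fixes e \<mu> :: "'a \<Rightarrow> real"
  assumes W: "finite W" and d: "0 \<le> d"
    and e: "\<And>v. e v \<le> d + (\<Sum>w\<in>{w\<in>W. \<mu> w < \<mu> v}. e w)"
  shows "e v \<le> d * (1 + real (card W)) ^ card {w\<in>W. \<mu> w < \<mu> v}"
proof (induction "card {w\<in>W. \<mu> w < \<mu> v}" arbitrary: v rule: less_induct)
  case (less v)
  let ?L = "{w\<in>W. \<mu> w < \<mu> v}"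
  let ?b = "1 + real (card W)"
  show ?case
  proof (cases "?L = {}")
    case True
    then show ?thesis
      unfolding True using e[of v, unfolded True] by simp
  next
    case False
    \<comment> \<open>Every \<open>w\<close> in \<open>?L\<close> has at most \<open>r\<close>
      elements below it, one fewer than \<open>v\<close>. The spare factor absorbs \<open>d\<close>
      and the sum over \<open>?L\<close>.\<close>
    then obtain r where r: "card ?L = Suc r"
      using W by (cases "card ?L") auto
    have "e w \<le> d * ?b ^ r" if "w \<in> ?L" for w
    proof -
      have "{u\<in>W. \<mu> u < \<mu> w} \<subset> ?L"
        using that by auto
      then have lt: "card {u\<in>W. \<mu> u < \<mu> w} < card ?L"
        using W by (intro psubset_card_mono) auto
      have "e w \<le> d * ?b ^ card {u\<in>W. \<mu> u < \<mu> w}"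
        by (rule less.hyps[OF lt])
      also have "\<dots> \<le> d * ?b ^ r"
        using lt r d by (intro mult_left_mono power_increasing) auto
      finally show ?thesis .
    qed
    then have "(\<Sum>w\<in>?L. e w) \<le> real (card ?L) * (d * ?b ^ r)"
      using sum_bounded_above[of ?L e] by blast
    also have "\<dots> \<le> real (card W) * (d * ?b ^ r)"
      using W d by (intro mult_right_mono) (auto intro!: card_mono)
    finally have "e v \<le> d * 1 + real (card W) * (d * ?b ^ r)"
      using e[of v] by linarith
    also have "\<dots> \<le> d * ?b ^ r + real (card W) * (d * ?b ^ r)"
      using d by (intro add_right_mono mult_left_mono one_le_power) auto
    finally show ?thesis
      by (simp add: r algebra_simps)
  qed
qed

text \<open>The recursion of \<open>min_sum_map_coord_diff\<close> is solved by
  \<open>geometric_growth_bound\<close>, with level \<open>min (coord y v) (coord z v)\<close>. Both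
  base and depth are controlled by the size of the joint support.\<close>

lemma min_sum_map_inverse_Lipschitz:
  assumes nonneg: "\<And>v. 0 \<le> coord y v" "\<And>v. 0 \<le> coord z v"
    and card: "card (support y) \<le> n" "card (support z) \<le> n"
  shows "linf_dist y z \<le> (1 + real (2 * n)) ^ (2 * n) * linf_dist (min_sum_map y) (min_sum_map z)"
  unfolding linf_dist_le_iff
proof
  fix v
  let ?W = "support y \<union> support z"
  let ?\<mu> = "\<lambda>v. min (coord y v) (coord z v)"
  let ?d = "linf_dist (min_sum_map y) (min_sum_map z)"
  let ?r = "card {w\<in>?W. ?\<mu> w < ?\<mu> v}"
  have W: "card ?W \<le> 2 * n"
    by (rule card_support_union_le[OF card])
  have "?r \<le> card ?W"
    by (rule card_mono) auto
  with W have r: "?r \<le> 2 * n"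
    by linarith
  have "\<bar>coord y v - coord z v\<bar> \<le> ?d * (1 + real (card ?W)) ^ ?r"
    by (rule geometric_growth_bound[OF _ linf_dist_nonneg min_sum_map_coord_diff[OF nonneg]]) auto
  also have "\<dots> \<le> ?d * (1 + real (2 * n)) ^ ?r"
    using W by (intro mult_left_mono power_mono linf_dist_nonneg) auto
  also have "\<dots> \<le> ?d * (1 + real (2 * n)) ^ (2 * n)"
    using r by (intro mult_left_mono power_increasing linf_dist_nonneg) auto
  finally show "\<bar>coord y v - coord z v\<bar> \<le> (1 + real (2 * n)) ^ (2 * n) * ?d"
    by (simp add: mult.commute)
qed

section \<open>The image of \<open>min_sum_map\<close> and its affinity on chambers\<close>

lemma min_sum_map_in_flag_complex:
  assumes K: "abstract_simplicial_complex K" and y: "y \<in> \<parallel>K\<parallel>\<^sub>K"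
  shows "min_sum_map y \<in> \<bar>K\<bar>\<^sub>K"
proof -
  have nonneg: "\<And>v. 0 \<le> coord y v" and total: "coord_sum y = 1" and supp: "support y \<in> K"
    using y uniform_complex_eq[OF K] by auto
  note lookup = lookup_min_sum_map[OF nonneg finite_keys order_refl]
  have pos: "0 < coord (min_sum_map y) v" if v: "v \<in> support y" for v
  proof -
    have "0 < coord y v"
      using nonneg[of v] v by (simp add: in_keys_iff order_less_le)
    also have "coord y v = min (coord y v) (coord y v)"
      by simp
    also have "\<dots> \<le> coord (min_sum_map y) v"
      unfolding lookup
      by (rule member_le_sum[OF v, of "\<lambda>w. min (coord y w) (coord y v)"]) (use nonneg in auto)
    finally show ?thesis .
  qed
  have zero: "coord (min_sum_map y) v = 0" if "v \<notin> support y" for v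
    unfolding lookup using that nonneg by (simp add: in_keys_iff)
  have "support (min_sum_map y) = support y"
    using pos zero by (auto simp: in_keys_iff) (metis in_keys_iff less_irrefl)
  moreover have "0 \<le> coord (min_sum_map y) v" for v
    unfolding lookup using nonneg by (intro sum_nonneg) auto
  moreover have "coord (min_sum_map y) v \<le> 1" for v
    unfolding lookup total[symmetric] coord_sum_def by (intro sum_mono) auto
  moreover have "\<exists>v. coord (min_sum_map y) v = 1"
  proof -
    have "support y \<noteq> {}"
      using total by (auto simp: coord_sum_def)
    then obtain u where "\<And>v. coord y v \<le> coord y u"
      using obtain_max_coord[OF nonneg] by blast
    \<comment> \<open>At a vertex with the largest coordinate each minimum is
      \<open>coord y w\<close>, so the sum is the total, 1.\<close>
    then have "coord (min_sum_map y) u = 1"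
      unfolding lookup total[symmetric] coord_sum_def by (simp add: min_absorb1)
    then show ?thesis ..
  qed
  ultimately show ?thesis
    using supp flag_complex_eq[OF K] by auto
qed

text \<open>By comonotonicity, the same one of \<open>v\<close> and \<open>w\<close> attains the
  minimum for both vectors. So \<open>min\<close> commutes with nonnegative combinations.\<close>

lemma min_sum_map_affine:
  assumes "y \<in> chamber vs" "z \<in> chamber vs" "0 \<le> a" "0 \<le> b"
  shows "min_sum_map (a *\<^sub>R y + b *\<^sub>R z) = a *\<^sub>R min_sum_map y + b *\<^sub>R min_sum_map z"
proof (rule poly_mapping_eqI)
  fix v
  have lookup: "coord (min_sum_map x) v = (\<Sum>w\<in>set vs. min (coord x w) (coord x v))"
    if "x \<in> chamber vs" for x
    using that by (intro lookup_min_sum_map) (auto simp: chamber_def)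
  have "min (a * coord y w + b * coord z w) (a * coord y v + b * coord z v) =
      a * min (coord y w) (coord y v) + b * min (coord z w) (coord z v)" for w
    using chamber_comonotone[OF assms(1,2), of v w] assms(3,4)
    by (auto simp: min_absorb1 min_absorb2 intro!: min_absorb1 min_absorb2 add_mono mult_left_mono)
  then show "coord (min_sum_map (a *\<^sub>R y + b *\<^sub>R z)) v = coord (a *\<^sub>R min_sum_map y + b *\<^sub>R min_sum_map z) v"
    using assms
    by (simp add: lookup lookup_add chamber_affine sum.distrib sum_distrib_left)
qed

lemma min_sum_map_vertex_sum:
  assumes "distinct vs"
  shows "min_sum_map ((1 / real (length vs)) *\<^sub>R vertex_sum vs) = vertex_sum vs"
proof (rule poly_mapping_eqI)
  fix v
  have supp: "support ((1 / real (length vs)) *\<^sub>R vertex_sum vs) \<subseteq> set vs"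
    by (rule order_trans[OF keys_scaleR_subset keys_vertex_sum])
  show "coord (min_sum_map ((1 / real (length vs)) *\<^sub>R vertex_sum vs)) v = coord (vertex_sum vs) v"
    using assms
    by (subst lookup_min_sum_map[OF _ _ supp]) (auto simp: lookup_vertex_sum distinct_card)
qed

section \<open>The radial-affine map\<close>

text \<open>For distinct \<open>vs\<close>, this is the simplex of the barycentric subdivision
  spanned by the barycenters of the initial segments of \<open>vs\<close>.\<close>

definition cell :: "'v list \<Rightarrow> ('v \<Rightarrow>\<^sub>0 real) set" where
  "cell vs = {y \<in> chamber vs. coord_sum y = 1}"

lemma convex_cell: "convex (cell vs)"
  by (rule convexI) (simp add: cell_def chamber_affine coord_sum_add coord_sum_scaleR)

lemma vertex_average_in_cell:
  assumes "distinct vs" "i \<in> {1..length vs}"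
  shows "(1 / real i) *\<^sub>R vertex_sum (take i vs) \<in> cell vs"
  using assms vertex_sum_take_in_chamber[OF assms(1), of i]
  by (auto simp: cell_def chamber_scaleR coord_sum_scaleR coord_sum_vertex_sum)

text \<open>The image of a convex cell under a map affine on it is convex, and it contains the
  generators of the flag simplex as images of barycenters.\<close>

lemma flag_simplex_subset_image_cell:
  assumes "distinct vs"
  shows "flag_simplex vs \<subseteq> min_sum_map ` cell vs"
  unfolding flag_simplex_def
proof (rule hull_minimal)
  show "convex (min_sum_map ` cell vs)"
  proof (rule convexI)
    fix x x' and a b :: real
    assume "x \<in> min_sum_map ` cell vs" "x' \<in> min_sum_map ` cell vs" and ab: "0 \<le> a" "0 \<le> b" "a + b = 1"
    then obtain y y' where y: "y \<in> cell vs" "y' \<in> cell vs" "x = min_sum_map y" "x' = min_sum_map y'"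
      by blast
    then have "a *\<^sub>R x + b *\<^sub>R x' = min_sum_map (a *\<^sub>R y + b *\<^sub>R y')"
      using ab by (subst min_sum_map_affine) (auto simp: cell_def)
    then show "a *\<^sub>R x + b *\<^sub>R x' \<in> min_sum_map ` cell vs"
      using convexD[OF convex_cell y(1,2) ab] by blast
  qed
  show "(\<lambda>i. vertex_sum (take i vs)) ` {1..length vs} \<subseteq> min_sum_map ` cell vs"
  proof clarify
    fix i assume i: "i \<in> {1..length vs}"
    have "min_sum_map ((1 / real i) *\<^sub>R vertex_sum (take i vs)) = vertex_sum (take i vs)"
      using min_sum_map_vertex_sum[of "take i vs"] assms i by simp
    then show "vertex_sum (take i vs) \<in> min_sum_map ` cell vs"
      using vertex_average_in_cell[OF assms i] by (metis imageI)
  qed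
qed

lemma cell_subset_uniform_complex:
  assumes K: "abstract_simplicial_complex K" and vs: "vs \<in> ordered_collections K"
  shows "cell vs \<subseteq> \<parallel>K\<parallel>\<^sub>K"
proof
  fix y assume y: "y \<in> cell vs"
  obtain \<sigma> where \<sigma>: "\<sigma> \<in> K" "set vs \<subseteq> \<sigma>"
    using vs by (auto simp: ordered_collections_def)
  have "support y \<noteq> {}" "support y \<subseteq> \<sigma>"
    using y \<sigma>(2) by (auto simp: cell_def coord_sum_def chamber_def)
  then have "support y \<in> K"
    using K \<sigma>(1) unfolding abstract_simplicial_complex_def by blast
  then show "y \<in> \<parallel>K\<parallel>\<^sub>K"
    using y uniform_complex_eq[OF K] by (auto simp: cell_def chamber_def)
qed

lemma bij_betw_min_sum_map:
  assumes K: "abstract_simplicial_complex K"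
  shows "bij_betw min_sum_map \<parallel>K\<parallel>\<^sub>K \<bar>K\<bar>\<^sub>K"
  unfolding bij_betw_def
proof (intro conjI equalityI)
  show "inj_on min_sum_map \<parallel>K\<parallel>\<^sub>K"
  proof (rule inj_onI)
    fix y z assume y: "y \<in> \<parallel>K\<parallel>\<^sub>K" and z: "z \<in> \<parallel>K\<parallel>\<^sub>K" and eq: "min_sum_map y = min_sum_map z"
    \<comment> \<open>A common bound for the supports of this one pair; the inverse Lipschitz
      estimate with it forces distance 0.\<close>
    let ?n = "max (card (support y)) (card (support z))"
    have "linf_dist y z \<le> (1 + real (2 * ?n)) ^ (2 * ?n) * linf_dist (min_sum_map y) (min_sum_map z)"
      using y z uniform_complex_eq[OF K] by (intro min_sum_map_inverse_Lipschitz) auto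
    then have "linf_dist y z \<le> 0"
      by (simp add: eq linf_dist_def)
    then show "y = z"
      by (intro poly_mapping_eqI) (simp add: linf_dist_le_iff)
  qed
  show "min_sum_map ` \<parallel>K\<parallel>\<^sub>K \<subseteq> \<bar>K\<bar>\<^sub>K"
    using min_sum_map_in_flag_complex[OF K] by blast
  show "\<bar>K\<bar>\<^sub>K \<subseteq> min_sum_map ` \<parallel>K\<parallel>\<^sub>K"
  proof
    fix x assume "x \<in> \<bar>K\<bar>\<^sub>K"
    then obtain vs where "vs \<in> ordered_collections K" "x \<in> flag_simplex vs"
      by (auto simp: flag_complex_def)
    then show "x \<in> min_sum_map ` \<parallel>K\<parallel>\<^sub>K"
      using flag_simplex_subset_image_cell[of vs] cell_subset_uniform_complex[OF K, of vs]
      by (auto simp: ordered_collections_def)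
  qed
qed

section \<open>Uniqueness and existence of the radial-affine map\<close>

lemma radial_affine_map_unique:
  assumes f: "is_radial_affine_map K f" and g: "is_radial_affine_map K g" and x: "x \<in> \<bar>K\<bar>\<^sub>K"
  shows "f x = g x"
proof -
  obtain vs where vs: "vs \<in> ordered_collections K" and x: "x \<in> flag_simplex vs"
    using x by (auto simp: flag_complex_def)
  have aff: "affine_map_on (flag_simplex vs) f" "affine_map_on (flag_simplex vs) g"
    using f g vs by (auto simp: is_radial_affine_map_def)
  have "flag_simplex vs \<subseteq> {x \<in> flag_simplex vs. f x = g x}"
    unfolding flag_simplex_def[of vs]
  proof (rule hull_minimal, fold flag_simplex_def[of vs])
    \<comment> \<open>Two affine maps agree on a convex set, so agreement at the generators spreads
      to their hull.\<close>
    show "convex {x \<in> flag_simplex vs. f x = g x}"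
      unfolding convex_alt
    proof (intro ballI allI impI CollectI conjI)
      fix x y and u :: real
      assume xy: "x \<in> {x \<in> flag_simplex vs. f x = g x}" "y \<in> {x \<in> flag_simplex vs. f x = g x}"
        and u: "0 \<le> u \<and> u \<le> 1"
      show "(1 - u) *\<^sub>R x + u *\<^sub>R y \<in> flag_simplex vs"
        using xy u convex_convex_hull unfolding flag_simplex_def convex_alt by blast
      show "f ((1 - u) *\<^sub>R x + u *\<^sub>R y) = g ((1 - u) *\<^sub>R x + u *\<^sub>R y)"
        using xy u aff by (simp add: affine_map_on_def)
    qed
    show "(\<lambda>i. vertex_sum (take i vs)) ` {1..length vs} \<subseteq> {x \<in> flag_simplex vs. f x = g x}"
    proof clarify
      fix i assume i: "i \<in> {1..length vs}"
      \<comment> \<open>An initial segment is again an ordered collection, so the values at all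
        generators are prescribed.\<close>
      have "take i vs \<in> ordered_collections K"
        using vs i by (auto simp: ordered_collections_def dest: in_set_takeD)
      then show "vertex_sum (take i vs) \<in> flag_simplex vs \<and>
          f (vertex_sum (take i vs)) = g (vertex_sum (take i vs))"
        using f g i by (auto simp: is_radial_affine_map_def flag_simplex_def hull_inc)
    qed
  qed
  then show ?thesis
    using x by blast
qed

text \<open>Allows the inverse of \<open>min_sum_map\<close> to be restricted to an extensional
  function, as the definite description requires.\<close>

lemma is_radial_affine_map_cong:
  assumes f: "is_radial_affine_map K f" and eq: "\<And>x. x \<in> \<bar>K\<bar>\<^sub>K \<Longrightarrow> f x = g x"
  shows "is_radial_affine_map K g"
proof -
  have in_K: "x \<in> \<bar>K\<bar>\<^sub>K" if "vs \<in> ordered_collections K" "x \<in> flag_simplex vs" for x vs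
    using that by (auto simp: flag_complex_def)
  have "vertex_sum vs \<in> flag_simplex vs" if "vs \<in> ordered_collections K" for vs
    using that unfolding flag_simplex_def ordered_collections_def
    by (intro hull_inc image_eqI[of _ _ "length vs"]) (auto simp: Suc_le_eq)
  then have "g (vertex_sum vs) = (1 / real (length vs)) *\<^sub>R vertex_sum vs"
    if "vs \<in> ordered_collections K" for vs
    using that f eq[OF in_K, of vs "vertex_sum vs"] by (simp add: is_radial_affine_map_def)
  moreover have "affine_map_on (flag_simplex vs) g" if vs: "vs \<in> ordered_collections K" for vs
    unfolding affine_map_on_def
  proof (intro ballI)
    fix x y and t :: real
    assume xy: "x \<in> flag_simplex vs" "y \<in> flag_simplex vs" and t: "t \<in> {0..1}"
    have "(1 - t) *\<^sub>R x + t *\<^sub>R y \<in> flag_simplex vs"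
      unfolding flag_simplex_def
      by (rule convexD[OF convex_convex_hull]) (use xy t in \<open>auto simp: flag_simplex_def\<close>)
    moreover have "f ((1 - t) *\<^sub>R x + t *\<^sub>R y) = (1 - t) *\<^sub>R f x + t *\<^sub>R f y"
      using f vs xy t by (simp add: is_radial_affine_map_def affine_map_on_def)
    ultimately show "g ((1 - t) *\<^sub>R x + t *\<^sub>R y) = (1 - t) *\<^sub>R g x + t *\<^sub>R g y"
      using eq[OF in_K[OF vs]] xy by simp
  qed
  ultimately show ?thesis
    by (simp add: is_radial_affine_map_def)
qed

text \<open>Points of a flag simplex are lifted to the cell. There \<open>min_sum_map\<close> is
  affine and injective, so its inverse is affine as well.\<close>

lemma is_radial_affine_map_inv_min_sum_map:
  assumes K: "abstract_simplicial_complex K"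
  shows "is_radial_affine_map K (inv_into \<parallel>K\<parallel>\<^sub>K min_sum_map)"
  unfolding is_radial_affine_map_def
proof (intro conjI ballI)
  fix vs assume vs: "vs \<in> ordered_collections K"
  let ?f = "inv_into \<parallel>K\<parallel>\<^sub>K min_sum_map"
  have inv: "?f (min_sum_map y) = y" if "y \<in> cell vs" for y
    using that bij_betw_min_sum_map[OF K] cell_subset_uniform_complex[OF K vs]
    by (auto simp: bij_betw_def inv_into_f_f)
  have dist: "distinct vs" and "vs \<noteq> []"
    using vs by (auto simp: ordered_collections_def)
  then have "(1 / real (length vs)) *\<^sub>R vertex_sum vs \<in> cell vs"
    using vertex_average_in_cell[of vs "length vs"] by (simp add: Suc_le_eq)
  from inv[OF this] show "?f (vertex_sum vs) = (1 / real (length vs)) *\<^sub>R vertex_sum vs"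
    by (simp only: min_sum_map_vertex_sum[OF dist])
  show "affine_map_on (flag_simplex vs) ?f"
    unfolding affine_map_on_def
  proof (intro ballI)
    fix x x' and t :: real
    assume "x \<in> flag_simplex vs" "x' \<in> flag_simplex vs" and t: "t \<in> {0..1}"
    then obtain y y' where y: "y \<in> cell vs" "y' \<in> cell vs" "x = min_sum_map y" "x' = min_sum_map y'"
      using flag_simplex_subset_image_cell[OF dist] by blast
    have "(1 - t) *\<^sub>R x + t *\<^sub>R x' = min_sum_map ((1 - t) *\<^sub>R y + t *\<^sub>R y')"
      using y t by (subst min_sum_map_affine) (auto simp: cell_def)
    moreover have "(1 - t) *\<^sub>R y + t *\<^sub>R y' \<in> cell vs"
      using y t by (intro convexD[OF convex_cell]) auto
    ultimately show "?f ((1 - t) *\<^sub>R x + t *\<^sub>R x') = (1 - t) *\<^sub>R ?f x + t *\<^sub>R ?f x'"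
      using y inv by simp
  qed
qed

lemma radial_affine_map_eq:
  assumes K: "abstract_simplicial_complex K" and x: "x \<in> \<bar>K\<bar>\<^sub>K"
  shows "radial_affine_map K x = inv_into \<parallel>K\<parallel>\<^sub>K min_sum_map x"
proof -
  let ?f = "restrict (inv_into \<parallel>K\<parallel>\<^sub>K min_sum_map) \<bar>K\<bar>\<^sub>K"
  have f: "is_radial_affine_map K ?f"
    by (rule is_radial_affine_map_cong[OF is_radial_affine_map_inv_min_sum_map[OF K]]) simp
  have "radial_affine_map K = ?f"
    unfolding radial_affine_map_def
  proof (rule the_equality)
    fix g assume "g \<in> extensional \<bar>K\<bar>\<^sub>K \<and> is_radial_affine_map K g"
    then show "g = ?f"
      using radial_affine_map_unique[OF _ f] by (intro extensionalityI[of g "\<bar>K\<bar>\<^sub>K"]) auto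
  qed (use f in simp)
  then show ?thesis
    using x by simp
qed

lemma bij_betw_radial_affine_map:
  assumes K: "abstract_simplicial_complex K"
  shows "bij_betw (radial_affine_map K) \<bar>K\<bar>\<^sub>K \<parallel>K\<parallel>\<^sub>K"
  using bij_betw_inv_into[OF bij_betw_min_sum_map[OF K]] radial_affine_map_eq[OF K]
  by (simp cong: bij_betw_cong)

lemma min_sum_map_radial_affine_map:
  assumes K: "abstract_simplicial_complex K" and x: "x \<in> \<bar>K\<bar>\<^sub>K"
  shows "min_sum_map (radial_affine_map K x) = x"
  using bij_betw_inv_into_right[OF bij_betw_min_sum_map[OF K] x] radial_affine_map_eq[OF K x] by simp

section \<open>The radial map\<close>

lemma radial_map_coord_sum: "radial_map x = x /\<^sub>R coord_sum x"
  by (simp add: radial_map_def coord_sum_def)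

lemma coord_sum_flag_complex:
  assumes K: "abstract_simplicial_complex K" and x: "x \<in> \<bar>K\<bar>\<^sub>K"
  shows "1 \<le> coord_sum x" "card (support x) \<le> n \<Longrightarrow> coord_sum x \<le> real n"
proof -
  have range: "0 \<le> coord x v" "coord x v \<le> 1" for v
    using x flag_complex_eq[OF K] by auto
  obtain u where u: "coord x u = 1"
    using x flag_complex_eq[OF K] by auto
  then have "u \<in> support x"
    by (simp add: in_keys_iff)
  then have "coord x u \<le> coord_sum x"
    unfolding coord_sum_def using range by (intro member_le_sum) auto
  then show "1 \<le> coord_sum x"
    by (simp add: u)
  show "coord_sum x \<le> real n" if "card (support x) \<le> n"
    unfolding coord_sum_def using sum_bounded_above[of "support x" "coord x" 1] range that by simp
qed

lemma radial_map_Lipschitz: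
  assumes K: "abstract_simplicial_complex K" and x: "x \<in> \<bar>K\<bar>\<^sub>K" and z: "z \<in> \<bar>K\<bar>\<^sub>K"
    and card: "card (support x) \<le> n" "card (support z) \<le> n"
  shows "linf_dist (radial_map x) (radial_map z) \<le> (1 + real (2 * n)) * linf_dist x z"
  unfolding linf_dist_le_iff
proof
  fix v
  let ?s = "coord_sum x" and ?r = "coord_sum z"
  have s: "1 \<le> ?s" and r: "1 \<le> ?r"
    using coord_sum_flag_complex[OF K] x z by auto
  have zv: "0 \<le> coord z v" "coord z v \<le> 1"
    using z flag_complex_eq[OF K] by auto
  \<comment> \<open>Splits the change of numerator from the change of denominator; both denominators
    are at least 1.\<close>
  have "coord (radial_map x) v - coord (radial_map z) v =
      (coord x v - coord z v) / ?s + coord z v * (?r - ?s) / (?s * ?r)"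
    using s r by (simp add: radial_map_coord_sum field_simps)
  then have "\<bar>coord (radial_map x) v - coord (radial_map z) v\<bar> \<le>
      \<bar>coord x v - coord z v\<bar> / ?s + coord z v * \<bar>?r - ?s\<bar> / (?s * ?r)"
    using s r zv abs_triangle_ineq[of "(coord x v - coord z v) / ?s" "coord z v * (?r - ?s) / (?s * ?r)"]
    by (simp add: abs_mult)
  also have "\<dots> \<le> \<bar>coord x v - coord z v\<bar> / 1 + 1 * \<bar>?r - ?s\<bar> / (1 * 1)"
    using s r zv by (intro add_mono frac_le mult_mono) auto
  also have "\<dots> \<le> linf_dist x z + real (2 * n) * linf_dist x z"
    using lookup_diff_le_linf_dist[of x v z] coord_sum_Lipschitz[OF card]
    by (simp add: abs_minus_commute)
  finally show "\<bar>coord (radial_map x) v - coord (radial_map z) v\<bar> \<le> (1 + real (2 * n)) * linf_dist x z"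
    by (simp add: algebra_simps)
qed

text \<open>At a vertex where \<open>x\<close> has coordinate 1, the radial images have coordinates
  \<open>1 / ?s\<close> and at most \<open>1 / ?r\<close>. Multiplying the gap by
  \<open>?s * ?r\<close>, which is at most \<open>n\<close> squared, gives the bound.\<close>

lemma coord_sum_diff_le_radial_map:
  assumes K: "abstract_simplicial_complex K" and x: "x \<in> \<bar>K\<bar>\<^sub>K" and z: "z \<in> \<bar>K\<bar>\<^sub>K"
    and card: "card (support x) \<le> n" "card (support z) \<le> n"
  shows "coord_sum z - coord_sum x \<le> (real n)\<^sup>2 * linf_dist (radial_map x) (radial_map z)"
proof -
  let ?s = "coord_sum x" and ?r = "coord_sum z" and ?d = "linf_dist (radial_map x) (radial_map z)"
  have s: "1 \<le> ?s" "?s \<le> real n" and r: "1 \<le> ?r" "?r \<le> real n"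
    using coord_sum_flag_complex[OF K] x z card by auto
  obtain u where u: "coord x u = 1"
    using x flag_complex_eq[OF K] by auto
  have "coord z u \<le> 1"
    using z flag_complex_eq[OF K] by auto
  have "1 / ?s - coord z u / ?r \<le> ?d"
    using lookup_diff_le_linf_dist[of "radial_map x" u "radial_map z"] u
    by (simp add: radial_map_coord_sum divide_inverse mult.commute)
  moreover have "coord z u / ?r \<le> 1 / ?r"
    using r \<open>coord z u \<le> 1\<close> by (intro divide_right_mono) auto
  ultimately have *: "1 / ?s - 1 / ?r \<le> ?d"
    by linarith
  have "?r - ?s = (?s * ?r) * (1 / ?s - 1 / ?r)"
    using s r by (simp add: field_simps)
  also have "\<dots> \<le> (?s * ?r) * ?d"
    using s r * by (intro mult_left_mono) auto
  also have "\<dots> \<le> (real n * real n) * ?d"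
    using s r by (intro mult_right_mono mult_mono linf_dist_nonneg) auto
  finally show ?thesis
    by (simp add: power2_eq_square)
qed

lemma radial_map_inverse_Lipschitz:
  assumes K: "abstract_simplicial_complex K" and x: "x \<in> \<bar>K\<bar>\<^sub>K" and z: "z \<in> \<bar>K\<bar>\<^sub>K"
    and card: "card (support x) \<le> n" "card (support z) \<le> n"
  shows "linf_dist x z \<le> (real n + (real n)\<^sup>2) * linf_dist (radial_map x) (radial_map z)"
  unfolding linf_dist_le_iff
proof
  fix v
  let ?s = "coord_sum x" and ?r = "coord_sum z" and ?d = "linf_dist (radial_map x) (radial_map z)"
  have s: "1 \<le> ?s" "?s \<le> real n" and r: "1 \<le> ?r"
    using coord_sum_flag_complex[OF K] x z card by auto
  have zv: "0 \<le> coord z v" "coord z v \<le> 1"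
    using z flag_complex_eq[OF K] by auto
  have sym: "linf_dist (radial_map z) (radial_map x) = ?d"
    by (simp add: linf_dist_def abs_minus_commute)
  have sr: "\<bar>?s - ?r\<bar> \<le> (real n)\<^sup>2 * ?d"
    using coord_sum_diff_le_radial_map[OF K x z card] coord_sum_diff_le_radial_map[OF K z x card(2,1)]
    unfolding sym by linarith
  \<comment> \<open>Undoes the normalization: \<open>?s\<close> scales the difference of the images,
    and the second term corrects for the unequal coordinate sums.\<close>
  have "coord x v - coord z v =
      ?s * (coord (radial_map x) v - coord (radial_map z) v) + (?s - ?r) * (coord z v / ?r)"
    using s r by (simp add: radial_map_coord_sum field_simps)
  then have "\<bar>coord x v - coord z v\<bar> \<le>
      \<bar>?s * (coord (radial_map x) v - coord (radial_map z) v)\<bar> + \<bar>(?s - ?r) * (coord z v / ?r)\<bar>"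
    by (simp only: abs_triangle_ineq)
  also have "\<dots> = ?s * \<bar>coord (radial_map x) v - coord (radial_map z) v\<bar> + \<bar>?s - ?r\<bar> * (coord z v / ?r)"
    using s r zv by (simp add: abs_mult)
  also have "\<dots> \<le> real n * ?d + ((real n)\<^sup>2 * ?d) * 1"
    using s r zv sr lookup_diff_le_linf_dist[of "radial_map x" v "radial_map z"]
    by (intro add_mono mult_mono) (auto simp: divide_le_eq intro: order_trans)
  finally show "\<bar>coord x v - coord z v\<bar> \<le> (real n + (real n)\<^sup>2) * ?d"
    by (simp add: algebra_simps)
qed

lemma bij_betw_radial_map:
  assumes K: "abstract_simplicial_complex K"
  shows "bij_betw radial_map \<bar>K\<bar>\<^sub>K \<parallel>K\<parallel>\<^sub>K"
  unfolding bij_betw_def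
proof (intro conjI equalityI subsetI)
  show "inj_on radial_map \<bar>K\<bar>\<^sub>K"
  proof (rule inj_onI)
    fix x z assume x: "x \<in> \<bar>K\<bar>\<^sub>K" and z: "z \<in> \<bar>K\<bar>\<^sub>K" and eq: "radial_map x = radial_map z"
    let ?n = "max (card (support x)) (card (support z))"
    have "linf_dist x z \<le> (real ?n + (real ?n)\<^sup>2) * linf_dist (radial_map x) (radial_map z)"
      by (rule radial_map_inverse_Lipschitz[OF K x z]) auto
    then have "linf_dist x z \<le> 0"
      by (simp add: eq linf_dist_def)
    then show "x = z"
      by (intro poly_mapping_eqI) (simp add: linf_dist_le_iff)
  qed
next
  fix y assume "y \<in> radial_map ` \<bar>K\<bar>\<^sub>K"
  then obtain x where x: "x \<in> \<bar>K\<bar>\<^sub>K" and y: "y = x /\<^sub>R coord_sum x"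
    by (auto simp: radial_map_coord_sum)
  have "1 \<le> coord_sum x"
    by (rule coord_sum_flag_complex[OF K x])
  then show "y \<in> \<parallel>K\<parallel>\<^sub>K"
    using x by (simp add: y uniform_complex_eq[OF K] flag_complex_eq[OF K] support_scaleR coord_sum_scaleR)
next
  fix y assume "y \<in> \<parallel>K\<parallel>\<^sub>K"
  then have y: "support y \<in> K" "\<And>v. 0 \<le> coord y v" "coord_sum y = 1"
    by (auto simp: uniform_complex_eq[OF K])
  then have "support y \<noteq> {}"
    by (auto simp: coord_sum_def)
  then obtain u where pos: "0 < coord y u" and le: "\<And>v. coord y v \<le> coord y u"
    using obtain_max_coord[OF y(2)] by blast
  let ?m = "coord y u"
  \<comment> \<open>The inverse of \<open>radial_map\<close> rescales so that the largest coordinate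
    becomes 1.\<close>
  let ?x = "y /\<^sub>R ?m"
  have "coord ?x u = 1"
    using pos by simp
  then have "?x \<in> \<bar>K\<bar>\<^sub>K"
    using y le pos by (auto simp: flag_complex_eq[OF K] support_scaleR field_simps)
  moreover have "radial_map ?x = y"
    using pos y(3) by (simp add: radial_map_coord_sum coord_sum_scaleR)
  ultimately show "y \<in> radial_map ` \<bar>K\<bar>\<^sub>K"
    by (intro image_eqI[of _ _ ?x]) simp_all
qed

section \<open>Uniform homeomorphisms\<close>

lemma uniform_homeomorphism_bi_LipschitzI:
  assumes A: "A \<subseteq> formal_combinations V" and B: "B \<subseteq> formal_combinations V"
    and bij: "bij_betw f A B"
    and upper: "\<And>x y. x \<in> A \<Longrightarrow> y \<in> A \<Longrightarrow> linf_dist (f x) (f y) \<le> c * linf_dist x y"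
    and lower: "\<And>x y. x \<in> A \<Longrightarrow> y \<in> A \<Longrightarrow> linf_dist x y \<le> d * linf_dist (f x) (f y)"
  shows "uniform_homeomorphism (submetric (linf_metric V) A) (submetric (linf_metric V) B) f"
proof -
  have mspace: "mspace (submetric (linf_metric V) A) = A" "mspace (submetric (linf_metric V) B) = B"
    using A B by auto
  let ?g = "inv_into A f"
  have g: "?g y \<in> A" "f (?g y) = y" if "y \<in> B" for y
    using that bij bij_betw_inv_into_right[OF bij] by (auto simp: bij_betw_def inv_into_into)
  have "linf_dist (?g y) (?g z) \<le> d * linf_dist y z" if "y \<in> B" "z \<in> B" for y z
    using lower[of "?g y" "?g z"] g that by simp
  then have "Lipschitz_continuous_map (submetric (linf_metric V) B) (submetric (linf_metric V) A) ?g"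
    unfolding Lipschitz_continuous_map_def mspace using g by auto
  moreover have "Lipschitz_continuous_map (submetric (linf_metric V) A) (submetric (linf_metric V) B) f"
    unfolding Lipschitz_continuous_map_def mspace using upper bij_betwE[OF bij] by auto
  ultimately show ?thesis
    unfolding uniform_homeomorphism_def mspace
    using bij by (simp add: Lipschitz_imp_uniformly_continuous_map)
qed

theorem corollary4p4:
  fixes K :: "'v set set" and V :: "'v set"
  assumes "abstract_simplicial_complex K"
    and "V = vertex_set K"
    and "countable K"
    and "finite_dimensional_complex K"
  shows "uniform_homeomorphism
           (submetric (linf_metric V) \<bar>K\<bar>\<^sub>K) (submetric (linf_metric V) \<parallel>K\<parallel>\<^sub>K)
           (radial_affine_map K) \<and>
         uniform_homeomorphism
           (submetric (linf_metric V) \<bar>K\<bar>\<^sub>K) (submetric (linf_metric V) \<parallel>K\<parallel>\<^sub>K)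
           radial_map"
proof
  note K = assms(1)
  obtain n where n: "\<And>\<sigma>. \<sigma> \<in> K \<Longrightarrow> card \<sigma> \<le> n"
    using assms(4) unfolding finite_dimensional_complex_def by blast
  have card_flag: "card (support x) \<le> n" if "x \<in> \<bar>K\<bar>\<^sub>K" for x
    using that n by (simp add: flag_complex_eq[OF K])
  have uniform: "card (support y) \<le> n" "0 \<le> coord y v" if "y \<in> \<parallel>K\<parallel>\<^sub>K" for y v
    using that n by (simp_all add: uniform_complex_eq[OF K])
  have sub: "\<bar>K\<bar>\<^sub>K \<subseteq> formal_combinations V" "\<parallel>K\<parallel>\<^sub>K \<subseteq> formal_combinations V"
    unfolding assms(2) by (rule flag_complex_subset uniform_complex_subset)+
  show "uniform_homeomorphism (submetric (linf_metric V) \<bar>K\<bar>\<^sub>K) (submetric (linf_metric V) \<parallel>K\<parallel>\<^sub>K) radial_map"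
    by (rule uniform_homeomorphism_bi_LipschitzI[OF sub bij_betw_radial_map[OF K]])
      (use card_flag in \<open>auto intro: radial_map_Lipschitz[OF K] radial_map_inverse_Lipschitz[OF K]\<close>)
  show "uniform_homeomorphism (submetric (linf_metric V) \<bar>K\<bar>\<^sub>K) (submetric (linf_metric V) \<parallel>K\<parallel>\<^sub>K)
      (radial_affine_map K)"
  proof (rule uniform_homeomorphism_bi_LipschitzI[OF sub bij_betw_radial_affine_map[OF K]])
    fix x z assume x: "x \<in> \<bar>K\<bar>\<^sub>K" and z: "z \<in> \<bar>K\<bar>\<^sub>K"
    let ?a = "radial_affine_map K"
    have a: "?a x \<in> \<parallel>K\<parallel>\<^sub>K" "?a z \<in> \<parallel>K\<parallel>\<^sub>K"
      using bij_betwE[OF bij_betw_radial_affine_map[OF K]] x z by auto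
    note inv = min_sum_map_radial_affine_map[OF K x] min_sum_map_radial_affine_map[OF K z]
    note bounds = uniform(2)[OF a(1)] uniform(2)[OF a(2)] uniform(1)[OF a(1)] uniform(1)[OF a(2)]
    \<comment> \<open>\<open>min_sum_map\<close> inverts \<open>?a\<close>, so its inverse estimate
      bounds \<open>?a\<close> from above and its Lipschitz estimate bounds \<open>?a\<close> from
      below.\<close>
    show "linf_dist (?a x) (?a z) \<le> (1 + real (2 * n)) ^ (2 * n) * linf_dist x z"
      using min_sum_map_inverse_Lipschitz[OF bounds] by (simp only: inv)
    show "linf_dist x z \<le> real (2 * n) * linf_dist (?a x) (?a z)"
      using min_sum_map_Lipschitz[OF bounds] by (simp only: inv)
  qed
qed

end
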